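(* For every positive integer $n$, $ex^{lin}_4(n,P_3)\le n$; that is, every $P_3$-free linear quadruple system $H$ on $n$ vertices satisfies $|E(H)|\le n$. Moreover, equality $|E(H)|=n$ holds for a $P_3$-free linear quadruple system $H$ on $n$ vertices if and only if $H$ is a union of vertex-disjoint Steiner systems $S(2,4,13)$.
   Context: A quadruple system (4-uniform hypergraph) $H=(V(H),E(H))$ consists of a finite vertex set and a set of 4-element subsets of it, called edges or quadruples. It is linear if every pair of vertices is contained in at most one edge. $H$ is $F$-free if it contains no subhypergraph isomorphic to $F$ (not necessarily induced). $ex^{lin}_4(n,F)$ is the maximum number of edges in an $F$-free linear quadruple system on $n$ vertices. The linear 4-path $P_3$ has three quadruples $\{x_1,x_2,x_3,x_4\}$, $\{x_4,x_5,x_6,x_7\}$, $\{x_7,x_8,x_9,x_{10}\}$ with $x_1,\dots,x_{10}$ distinct. A Steiner system $S(2,4,m)$ is a pair $(V,\mathcal B)$ with $|V|=m$ and $\mathcal B$ a family of 4-element subsets of $V$ such that each 2-element subset of $V$ is contained in exactly one member of $\mathcal B$. *)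

theory Defs
  imports Main
begin

type_synonym 'a hypergraph = "'a set \<times> 'a set set"

abbreviation verts :: "'a hypergraph \<Rightarrow> 'a set" where
  "verts H \<equiv> fst H"

abbreviation edges :: "'a hypergraph \<Rightarrow> 'a set set" where
  "edges H \<equiv> snd H"

definition quadruple_system :: "'a hypergraph \<Rightarrow> bool" where
  "quadruple_system H \<longleftrightarrow>
     finite (verts H) \<and> (\<forall>e \<in> edges H. e \<subseteq> verts H \<and> card e = 4)"

definition linear_hypergraph :: "'a hypergraph \<Rightarrow> bool" where
  "linear_hypergraph H \<longleftrightarrow>
     (\<forall>x \<in> verts H. \<forall>y \<in> verts H. x \<noteq> y \<longrightarrow>
        (\<exists>\<^sub>\<le>\<^sub>1 e. e \<in> edges H \<and> {x, y} \<subseteq> e))"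

definition subhypergraph :: "'a hypergraph \<Rightarrow> 'a hypergraph \<Rightarrow> bool" where
  "subhypergraph G H \<longleftrightarrow>
     verts G \<subseteq> verts H \<and> edges G \<subseteq> edges H \<and> (\<forall>e \<in> edges G. e \<subseteq> verts G)"

definition isomorphic_hypergraphs :: "'a hypergraph \<Rightarrow> 'b hypergraph \<Rightarrow> bool" where
  "isomorphic_hypergraphs G H \<longleftrightarrow>
     (\<exists>f. bij_betw f (verts G) (verts H) \<and> (\<lambda>e. f ` e) ` edges G = edges H)"

definition hypergraph_free :: "'b hypergraph \<Rightarrow> 'a hypergraph \<Rightarrow> bool" where
  "hypergraph_free F H \<longleftrightarrow>
     \<not> (\<exists>G. subhypergraph G H \<and> isomorphic_hypergraphs F G)"

(* Up to isomorphism every finite system has its vertices in nat, so the vertex type nat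
   loses no systems; the set below may involve any n-element set of naturals. *)
definition lin_systems_nat :: "nat \<Rightarrow> 'b hypergraph \<Rightarrow> nat hypergraph set" where
  "lin_systems_nat n F =
     {H. quadruple_system H \<and> linear_hypergraph H \<and> hypergraph_free F H \<and> card (verts H) = n}"

definition ex_lin4 :: "nat \<Rightarrow> 'b hypergraph \<Rightarrow> nat" where
  "ex_lin4 n F = Max ((\<lambda>H. card (edges H)) ` lin_systems_nat n F)"

(* The maximum is attained whenever F has an edge. *)
lemma ex_lin4_well_defined:
  fixes F :: "'b hypergraph"
  assumes "edges F \<noteq> {}"
  shows "finite ((\<lambda>H. card (edges H)) ` lin_systems_nat n F)" and "lin_systems_nat n F \<noteq> {}"
proof -
  have bound: "card (edges H) \<le> 2 ^ n" if "H \<in> lin_systems_nat n F" for H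
  proof -
    from that have fin: "finite (verts H)" and sub: "edges H \<subseteq> Pow (verts H)"
      and n: "card (verts H) = n"
      by (auto simp: lin_systems_nat_def quadruple_system_def)
    from fin sub have "card (edges H) \<le> card (Pow (verts H))"
      by (intro card_mono) auto
    with fin n show ?thesis by (simp add: card_Pow)
  qed
  show "finite ((\<lambda>H. card (edges H)) ` lin_systems_nat n F)"
    by (rule finite_subset[OF image_subsetI finite_atMost[of "2 ^ n"]]) (simp only: atMost_iff bound)
  have "hypergraph_free F ({..<n}, {})"
    using assms unfolding hypergraph_free_def subhypergraph_def isomorphic_hypergraphs_def
    by (metis empty_is_image snd_conv subset_empty)
  then have "({..<n}, {}) \<in> lin_systems_nat n F"
    by (simp add: lin_systems_nat_def quadruple_system_def linear_hypergraph_def Uniq_def)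
  then show "lin_systems_nat n F \<noteq> {}" by blast
qed

definition path_P3 :: "nat hypergraph" where
  "path_P3 = ({1..10}, {{1, 2, 3, 4}, {4, 5, 6, 7}, {7, 8, 9, 10}})"

definition steiner_2_4 :: "nat \<Rightarrow> 'a hypergraph \<Rightarrow> bool" where
  "steiner_2_4 m S \<longleftrightarrow>
     finite (verts S) \<and> card (verts S) = m \<and>
     (\<forall>B \<in> edges S. B \<subseteq> verts S \<and> card B = 4) \<and>
     (\<forall>p. p \<subseteq> verts S \<and> card p = 2 \<longrightarrow> (\<exists>!B. B \<in> edges S \<and> p \<subseteq> B))"

definition disjoint_union_of_steiner_13 :: "'a hypergraph \<Rightarrow> bool" where
  "disjoint_union_of_steiner_13 H \<longleftrightarrow>
     (\<exists>\<S>. (\<forall>S \<in> \<S>. steiner_2_4 13 S) \<and>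
          (\<forall>S \<in> \<S>. \<forall>T \<in> \<S>. S \<noteq> T \<longrightarrow> verts S \<inter> verts T = {}) \<and>
          verts H = (\<Union>S \<in> \<S>. verts S) \<and>
          edges H = (\<Union>S \<in> \<S>. edges S))"

end

theory Submission
  imports Defs Complex_Main
begin

text \<open>
  The bound comes from charging each edge \<open>e\<close> with the weight \<open>\<Sum>x\<in>e. 1 / deg x\<close>. Summed over all
  edges, a vertex that lies on some edge contributes exactly \<open>1\<close>, so the total weight is at most
  \<open>n\<close>, and it suffices that every edge weighs at least \<open>1\<close>.

  Let \<open>a\<close> and \<open>b\<close> be two vertices of an edge \<open>f\<close>. An edge \<open>e \<noteq> f\<close> through \<open>a\<close> and an edge
  \<open>g \<noteq> f\<close> through \<open>b\<close> must meet, since otherwise \<open>e, f, g\<close> is a linear path. If such an \<open>e\<close>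
  exists, the edges \<open>g\<close> meet its three points other than \<open>a\<close>, each point being used at most
  once by linearity; hence \<open>deg b \<le> 4\<close> (lemma \<open>transversal\<close>). So either at least
  three vertices of \<open>f\<close> have degree \<open>1\<close>, and the weight is at least \<open>3\<close>, or all degrees on \<open>f\<close> are
  at most \<open>4\<close>, and the weight is at least \<open>4 / 4\<close> (lemma \<open>weight_ge_1\<close>).

  In the case of equality every vertex has degree \<open>4\<close>. The injection above, with the roles of
  \<open>a\<close> and \<open>b\<close> exchanged, then maps the three edges other than \<open>f\<close> through \<open>a\<close> onto the three points
  of any given edge other than \<open>f\<close> through \<open>b\<close>. So everything adjacent to \<open>b\<close> is adjacent to \<open>a\<close>:
  adjacent vertices have the same closed neighbourhood, which consists of \<open>1 + 4 * 3 = 13\<close> points.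
  The neighbourhoods therefore partition the vertex set, and within each of them every two points
  are adjacent, which is what a Steiner system demands. Conversely, in a disjoint union of systems
  \<open>S(2,4,13)\<close> the closed neighbourhoods have \<open>13\<close> points, so all degrees are \<open>4\<close> and double
  counting gives \<open>4 * card E = 4 * n\<close>.
\<close>

section \<open>Linear quadruple systems\<close>

locale linear_quadruples =
  fixes V :: "'a set" and E :: "'a set set"
  assumes finite_V: "finite V"
    and edge_subset: "e \<in> E \<Longrightarrow> e \<subseteq> V"
    and card_edge: "e \<in> E \<Longrightarrow> card e = 4"
    and edge_unique: "\<lbrakk>e \<in> E; g \<in> E; x \<in> e; x \<in> g; y \<in> e; y \<in> g; x \<noteq> y\<rbrakk> \<Longrightarrow> e = g"
begin

definition star :: "'a \<Rightarrow> 'a set set" where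
  "star x = {e \<in> E. x \<in> e}"

definition deg :: "'a \<Rightarrow> nat" where
  "deg x = card (star x)"

definition nbhd :: "'a \<Rightarrow> 'a set" where
  "nbhd x = \<Union> (star x)"

lemma finite_E: "finite E"
proof (rule finite_subset)
  show "E \<subseteq> Pow V" using edge_subset by blast
  show "finite (Pow V)" using finite_V by simp
qed

lemma finite_edge: "e \<in> E \<Longrightarrow> finite e"
  by (rule finite_subset[OF edge_subset finite_V])

lemma finite_star: "finite (star x)"
  unfolding star_def using finite_E by simp

lemma deg_pos_iff: "deg x > 0 \<longleftrightarrow> (\<exists>e\<in>E. x \<in> e)"
  using finite_star[of x] unfolding deg_def card_gt_0_iff star_def by blast

lemma deg_pos: "e \<in> E \<Longrightarrow> x \<in> e \<Longrightarrow> deg x > 0"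
  unfolding deg_pos_iff by blast

lemma nbhd_iff: "y \<in> nbhd x \<longleftrightarrow> (\<exists>e\<in>E. x \<in> e \<and> y \<in> e)"
  by (auto simp: nbhd_def star_def)

lemma nbhd_refl: "deg x > 0 \<Longrightarrow> x \<in> nbhd x"
  unfolding nbhd_iff deg_pos_iff by blast

text \<open>By linearity the edges through \<open>x\<close> share no point besides \<open>x\<close>.\<close>

lemma card_nbhd:
  assumes "deg x > 0"
  shows "card (nbhd x) = 1 + 3 * deg x"
proof -
  have "nbhd x - {x} = (\<Union>e\<in>star x. e - {x})"
    by (auto simp: nbhd_def)
  also have "card \<dots> = (\<Sum>e\<in>star x. card (e - {x}))"
  proof (rule card_UN_disjoint)
    show "\<forall>e\<in>star x. finite (e - {x})"
      by (simp add: star_def finite_edge)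
    show "\<forall>e\<in>star x. \<forall>g\<in>star x. e \<noteq> g \<longrightarrow> (e - {x}) \<inter> (g - {x}) = {}"
      unfolding star_def using edge_unique[of _ _ x] by blast
  qed (rule finite_star)
  also have "\<dots> = (\<Sum>e\<in>star x. 3)"
    by (rule sum.cong) (auto simp: star_def card_edge)
  finally have "card (nbhd x - {x}) = 3 * deg x"
    by (simp add: deg_def)
  moreover have "finite (nbhd x)"
    unfolding nbhd_def
    by (rule finite_Union[OF finite_star]) (simp add: star_def finite_edge)
  ultimately show ?thesis
    using card.remove[of "nbhd x" x] nbhd_refl[OF assms] by linarith
qed

lemma sum_deg: "(\<Sum>x\<in>V. deg x) = 4 * card E"
proof -
  have "(\<Sum>x\<in>V. card {e \<in> E. x \<in> e}) = (\<Sum>e\<in>E. 4)"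
  proof (rule sum_multicount_gen)
    show "\<forall>e\<in>E. card {x \<in> V. x \<in> e} = 4"
    proof
      fix e assume "e \<in> E"
      then have "{x \<in> V. x \<in> e} = e" using edge_subset by blast
      then show "card {x \<in> V. x \<in> e} = 4" using card_edge \<open>e \<in> E\<close> by simp
    qed
  qed (rule finite_V, rule finite_E)
  then show ?thesis by (simp add: deg_def star_def)
qed

definition weight :: "'a set \<Rightarrow> real" where
  "weight e = (\<Sum>x\<in>e. 1 / real (deg x))"

lemma sum_weight: "(\<Sum>e\<in>E. weight e) = card (\<Union>E)"
proof -
  have fin: "finite (\<Union>E)"
    by (rule finite_Union[OF finite_E]) (rule finite_edge)
  have "(\<Sum>e\<in>E. weight e) = (\<Sum>e\<in>E. \<Sum>x\<in>{x \<in> \<Union>E. x \<in> e}. 1 / real (deg x))"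
  proof (rule sum.cong[OF refl])
    fix e assume "e \<in> E"
    then have "{x \<in> \<Union>E. x \<in> e} = e" by blast
    then show "weight e = (\<Sum>x\<in>{x \<in> \<Union>E. x \<in> e}. 1 / real (deg x))"
      by (simp add: weight_def)
  qed
  also have "\<dots> = (\<Sum>x\<in>\<Union>E. \<Sum>e\<in>{e \<in> E. x \<in> e}. 1 / real (deg x))"
    by (rule sum.swap_restrict[OF finite_E fin])
  also have "\<dots> = (\<Sum>x\<in>\<Union>E. 1)"
  proof (rule sum.cong)
    fix x assume "x \<in> \<Union>E"
    then have "deg x > 0" using deg_pos by blast
    then show "(\<Sum>e\<in>{e \<in> E. x \<in> e}. 1 / real (deg x)) = 1"
      by (simp add: deg_def star_def)
  qed simp
  finally show ?thesis by simp
qed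

end

section \<open>Excluding the linear path\<close>

locale P3_free_quadruples = linear_quadruples +
  assumes ends_meet:
    "\<lbrakk>e \<in> E; f \<in> E; g \<in> E; a \<in> e; a \<in> f; b \<in> f; b \<in> g; a \<noteq> b; e \<noteq> f; g \<noteq> f\<rbrakk> \<Longrightarrow> e \<inter> g \<noteq> {}"
begin

text \<open>
  The edges through \<open>b\<close> meet \<open>e\<close> outside \<open>a\<close>, because \<open>f\<close> is the only edge on \<open>a\<close> and \<open>b\<close>. Two of
  them cannot use the same point, because they already share \<open>b\<close>, which is not on \<open>e\<close>.
\<close>

lemma transversal:
  assumes f: "f \<in> E" "a \<in> f" "b \<in> f" and ab: "a \<noteq> b" and e: "e \<in> E" "a \<in> e" "e \<noteq> f"
  shows "\<exists>h. inj_on h (star b - {f}) \<and> h ` (star b - {f}) \<subseteq> e - {a} \<and>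
    (\<forall>g\<in>star b - {f}. h g \<in> g)"
proof -
  have "\<exists>z. z \<in> e - {a} \<and> z \<in> g" if "g \<in> star b - {f}" for g
  proof -
    have g: "g \<in> E" "b \<in> g" "g \<noteq> f" using that by (auto simp: star_def)
    then obtain z where "z \<in> e" "z \<in> g"
      using ends_meet[of e f g a b] f ab e by blast
    moreover have "a \<notin> g" using edge_unique[of f g a b] f g ab by blast
    ultimately show ?thesis by blast
  qed
  then obtain h where h: "\<And>g. g \<in> star b - {f} \<Longrightarrow> h g \<in> e - {a} \<and> h g \<in> g"
    by metis
  have "b \<notin> e" using edge_unique[of f e a b] f e ab by blast
  then have "inj_on h (star b - {f})"
    using h by (intro inj_onI) (metis DiffD1 edge_unique mem_Collect_eq star_def)
  then show ?thesis using h by (intro exI[of _ h]) auto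
qed

lemma deg_le_4:
  assumes "f \<in> E" "a \<in> f" "b \<in> f" "a \<noteq> b" "deg a \<ge> 2"
  shows "deg b \<le> 4"
proof -
  have "star a \<noteq> {f}"
    using assms(5) by (auto simp: deg_def)
  moreover have "f \<in> star a"
    using assms(1,2) by (simp add: star_def)
  ultimately obtain e where "e \<in> star a" "e \<noteq> f"
    by blast
  then have e: "e \<in> E" "a \<in> e" "e \<noteq> f"
    by (simp_all add: star_def)
  obtain h where "inj_on h (star b - {f})" "h ` (star b - {f}) \<subseteq> e - {a}"
    using transversal[OF assms(1-4) e] by blast
  then have "card (star b - {f}) \<le> card (e - {a})"
    using finite_edge[OF e(1)] by (metis card_inj_on_le finite_Diff)
  also have "card (e - {a}) = 3"
    using e card_edge by simp
  finally show ?thesis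
    using assms by (simp add: deg_def star_def finite_E)
qed

text \<open>
  If at most one vertex of \<open>e\<close> has degree at least \<open>2\<close>, three others contribute \<open>1\<close> each.
  Otherwise every vertex of \<open>e\<close> shares it with another vertex of degree at least \<open>2\<close>.
\<close>

lemma heavy_or_bounded:
  assumes "e \<in> E"
  shows "weight e \<ge> 3 \<or> (\<forall>x\<in>e. deg x \<le> 4)"
proof (cases "\<exists>x\<in>e. \<forall>y\<in>e - {x}. deg y < 2")
  case True
  then obtain x where x: "x \<in> e" "\<forall>y\<in>e - {x}. deg y < 2" by blast
  have "deg y = 1" if "y \<in> e - {x}" for y
  proof -
    have "deg y < 2" "deg y > 0" using x(2) that deg_pos[OF assms] by blast+
    then show ?thesis by linarith
  qed
  then have "3 = (\<Sum>y\<in>e - {x}. 1 / real (deg y))"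
    using x(1) card_edge[OF assms] by simp
  also have "\<dots> \<le> weight e"
    unfolding weight_def by (rule sum_mono2) (auto simp: finite_edge[OF assms])
  finally show ?thesis by simp
next
  case False
  have "deg x \<le> 4" if "x \<in> e" for x
  proof -
    obtain y where "y \<in> e - {x}" "\<not> deg y < 2" using False \<open>x \<in> e\<close> by blast
    then show ?thesis using deg_le_4[OF assms, of y x] that by auto
  qed
  then show ?thesis by blast
qed

lemma weight_ge_1:
  assumes "e \<in> E"
  shows "weight e \<ge> 1"
proof (cases "\<forall>x\<in>e. deg x \<le> 4")
  case True
  have "1 = (\<Sum>x\<in>e. 1 / (4::real))"
    using card_edge[OF assms] by simp
  also have "\<dots> \<le> weight e"
    unfolding weight_def
  proof (rule sum_mono)
    fix x assume "x \<in> e"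
    then have "deg x > 0" "deg x \<le> 4" using True deg_pos[OF assms] by auto
    then show "1 / 4 \<le> 1 / real (deg x)" by (simp add: field_simps)
  qed
  finally show ?thesis .
qed (use heavy_or_bounded[OF assms] in linarith)

lemma deg_eq_4_if_weight_1:
  assumes e: "e \<in> E" and w: "weight e = 1" and x: "x \<in> e"
  shows "deg x = 4"
proof (rule ccontr)
  assume neq: "deg x \<noteq> 4"
  have le: "\<forall>y\<in>e. deg y \<le> 4" using heavy_or_bounded[OF e] w by linarith
  have quarter: "1 / 4 \<le> 1 / real (deg y)" if "y \<in> e" for y
  proof -
    have "deg y > 0" "deg y \<le> 4" using le that deg_pos[OF e] by auto
    then show ?thesis by (simp add: field_simps)
  qed
  have "1 / 4 < 1 / real (deg x)"
  proof -
    have "deg x > 0" "deg x < 4" using le x neq deg_pos[OF e] by force+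
    then show ?thesis by (simp add: field_simps)
  qed
  then have "(\<Sum>y\<in>e. 1 / (4::real)) < weight e"
    unfolding weight_def using quarter x finite_edge[OF e] by (intro sum_strict_mono_ex1) auto
  then show False using w card_edge[OF e] by simp
qed

theorem card_edges_le: "card E \<le> card V"
proof -
  have "real (card E) = (\<Sum>e\<in>E. 1)" by simp
  also have "\<dots> \<le> (\<Sum>e\<in>E. weight e)" by (rule sum_mono) (rule weight_ge_1)
  also have "\<dots> = card (\<Union>E)" by (rule sum_weight)
  finally have "card E \<le> card (\<Union>E)" by simp
  also have "\<dots> \<le> card V" using edge_subset by (intro card_mono finite_V) blast
  finally show ?thesis .
qed

section \<open>The case of equality\<close>

text \<open>
  Equality leaves no slack in the weight count: no vertex is isolated and no edge weighs more than
  \<open>1\<close>.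
\<close>

lemma regular_if_card_eq:
  assumes eq: "card E = card V" and x: "x \<in> V"
  shows "deg x = 4"
proof -
  have sub: "\<Union>E \<subseteq> V" using edge_subset by blast
  have ge: "real (card E) \<le> (\<Sum>e\<in>E. weight e)"
    using sum_mono[of E "\<lambda>_. 1" weight] weight_ge_1 by simp
  then have "card V \<le> card (\<Union>E)"
    using eq sum_weight by simp
  then have cover: "\<Union>E = V"
    using sub finite_V card_seteq by metis
  \<comment> \<open>A sum of nonnegative terms that vanishes, so each term vanishes.\<close>
  have "(\<Sum>e\<in>E. weight e - 1) = 0"
    using eq cover sum_weight by (simp add: sum_subtractf)
  then have "\<forall>e\<in>E. weight e - 1 = 0"
    using weight_ge_1 finite_E by (subst (asm) sum_nonneg_eq_0_iff) auto
  moreover obtain e where "e \<in> E" "x \<in> e" using x cover by blast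
  ultimately show ?thesis using deg_eq_4_if_weight_1 by simp
qed

text \<open>
  When \<open>deg a = 4\<close>, the three edges through \<open>a\<close> other than \<open>f\<close> occupy all three points other than
  \<open>b\<close> of each edge \<open>e \<noteq> f\<close> through \<open>b\<close>.
\<close>

lemma nbhd_subset_if_adjacent:
  assumes f: "f \<in> E" "a \<in> f" "b \<in> f" and deg: "deg a = 4"
  shows "nbhd b \<subseteq> nbhd a"
proof
  fix y assume "y \<in> nbhd b"
  then obtain e where e: "e \<in> E" "b \<in> e" "y \<in> e" by (auto simp: nbhd_iff)
  show "y \<in> nbhd a"
  proof (cases "a = b \<or> e = f \<or> y = b")
    case True
    then show ?thesis using e f by (auto simp: nbhd_iff)
  next
    case False
    then obtain h where h: "inj_on h (star a - {f})" "h ` (star a - {f}) \<subseteq> e - {b}"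
      "\<forall>g\<in>star a - {f}. h g \<in> g"
      using transversal[of f b a e] f e by blast
    have "card (h ` (star a - {f})) = card (star a - {f})"
      by (rule card_image) (rule h)
    also have "\<dots> = 3"
      using deg f by (simp add: deg_def star_def finite_E)
    also have "\<dots> = card (e - {b})"
      using e card_edge by simp
    finally have "h ` (star a - {f}) = e - {b}"
      using h(2) finite_edge[OF e(1)] by (metis card_subset_eq finite_Diff)
    then obtain g where "g \<in> star a - {f}" "y = h g"
      using e False by blast
    then show ?thesis using h(3) by (auto simp: nbhd_iff star_def)
  qed
qed

text \<open>
  The blocks are the closed neighbourhoods. Lying in \<open>nbhd x\<close> amounts to having the same
  neighbourhood as \<open>x\<close>, so two blocks sharing a vertex coincide, and two points \<open>y\<close>, \<open>z\<close> of one
  block satisfy \<open>z \<in> nbhd y\<close>, that is, some edge contains both.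
\<close>

lemma steiner_union_if_regular:
  assumes regular: "\<And>x. x \<in> V \<Longrightarrow> deg x = 4"
  shows "disjoint_union_of_steiner_13 (V, E)"
proof -
  define block where "block x = (nbhd x, {e \<in> E. e \<subseteq> nbhd x})" for x
  have nbhd_V: "nbhd x \<subseteq> V" for x
    unfolding nbhd_def star_def using edge_subset by blast
  have refl: "x \<in> nbhd x" if "x \<in> V" for x
    using that regular nbhd_refl by simp
  have same: "nbhd y = nbhd x" if y: "y \<in> nbhd x" for x y
  proof -
    obtain f where f: "f \<in> E" "x \<in> f" "y \<in> f" using y by (auto simp: nbhd_iff)
    then have "deg x = 4" "deg y = 4" using regular edge_subset by blast+
    then show ?thesis using nbhd_subset_if_adjacent f by blast
  qed
  have steiner: "steiner_2_4 13 (block x)" if x: "x \<in> V" for x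
    unfolding steiner_2_4_def block_def fst_conv snd_conv
  proof (intro conjI ballI allI impI)
    show "finite (nbhd x)" using nbhd_V finite_V finite_subset by blast
    show "card (nbhd x) = 13" using card_nbhd regular[OF x] by simp
  next
    fix p assume p: "p \<subseteq> nbhd x \<and> card p = 2"
    then obtain y z where yz: "p = {y, z}" "y \<noteq> z" by (auto simp: card_2_iff)
    then have "z \<in> nbhd y" using p same by blast
    then obtain e where e: "e \<in> E" "y \<in> e" "z \<in> e" by (auto simp: nbhd_iff)
    then have "e \<subseteq> nbhd y" by (auto simp: nbhd_iff)
    then have "e \<subseteq> nbhd x" using p yz same by blast
    show "\<exists>!B. B \<in> {e \<in> E. e \<subseteq> nbhd x} \<and> p \<subseteq> B"
    proof (rule ex1I)
      show "e \<in> {e \<in> E. e \<subseteq> nbhd x} \<and> p \<subseteq> e"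
        using e yz \<open>e \<subseteq> nbhd x\<close> by simp
    next
      fix B assume "B \<in> {e \<in> E. e \<subseteq> nbhd x} \<and> p \<subseteq> B"
      then have "B \<in> E" "y \<in> B" "z \<in> B" using yz by auto
      then show "B = e" using edge_unique e yz(2) by metis
    qed
  qed (auto simp: card_edge)
  show ?thesis
    unfolding disjoint_union_of_steiner_13_def
  proof (intro exI[of _ "block ` V"] conjI)
    show "\<forall>S\<in>block ` V. steiner_2_4 13 S" using steiner by blast
    show "\<forall>S\<in>block ` V. \<forall>T\<in>block ` V. S \<noteq> T \<longrightarrow> verts S \<inter> verts T = {}"
    proof (intro ballI impI, rule ccontr)
      fix S T assume ST: "S \<in> block ` V" "T \<in> block ` V" "S \<noteq> T" "verts S \<inter> verts T \<noteq> {}"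
      then obtain x y where xy: "S = block x" "T = block y" by blast
      then obtain z where "z \<in> nbhd x" "z \<in> nbhd y"
        using ST(4) by (auto simp: block_def)
      then have "nbhd x = nbhd y" using same by metis
      then show False using ST(3) xy by (simp add: block_def)
    qed
    show "verts (V, E) = (\<Union>S\<in>block ` V. verts S)"
      using refl nbhd_V by (auto simp: block_def)
    show "edges (V, E) = (\<Union>S\<in>block ` V. edges S)"
    proof
      show "edges (V, E) \<subseteq> (\<Union>S\<in>block ` V. edges S)"
      proof
        fix e assume "e \<in> edges (V, E)"
        then have e: "e \<in> E" by simp
        then obtain x where "x \<in> e" using card_edge[OF e] by fastforce
        then have "x \<in> V" "e \<subseteq> nbhd x" using e edge_subset by (auto simp: nbhd_iff)
        then show "e \<in> (\<Union>S\<in>block ` V. edges S)" using e by (auto simp: block_def)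
      qed
    qed (auto simp: block_def)
  qed
qed

end

text \<open>
  Each closed neighbourhood is the vertex set of one of the Steiner systems; its \<open>13\<close> points force
  degree \<open>4\<close>.
\<close>

lemma (in linear_quadruples) card_eq_if_steiner_union:
  assumes "disjoint_union_of_steiner_13 (V, E)"
  shows "card E = card V"
proof -
  obtain \<S> where steiner: "\<forall>S\<in>\<S>. steiner_2_4 13 S"
    and disjoint: "\<forall>S\<in>\<S>. \<forall>T\<in>\<S>. S \<noteq> T \<longrightarrow> verts S \<inter> verts T = {}"
    and V: "V = (\<Union>S\<in>\<S>. verts S)" and E: "E = (\<Union>S\<in>\<S>. edges S)"
    using assms unfolding disjoint_union_of_steiner_13_def fst_conv snd_conv
    by (elim exE conjE) (rule that)
  have "deg x = 4" if x: "x \<in> V" for x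
  proof -
    obtain S where S: "S \<in> \<S>" "x \<in> verts S" using x V by blast
    have card_S: "card (verts S) = 13"
      and pairs: "\<And>p. p \<subseteq> verts S \<Longrightarrow> card p = 2 \<Longrightarrow> \<exists>!B. B \<in> edges S \<and> p \<subseteq> B"
      using steiner S(1) by (simp_all add: steiner_2_4_def)
    have adjacent: "y \<in> nbhd x" if y: "y \<in> verts S" "y \<noteq> x" for y
    proof -
      have "{x, y} \<subseteq> verts S" "card {x, y} = 2" using y S by simp_all
      then obtain B where "B \<in> edges S" "{x, y} \<subseteq> B"
        using pairs[of "{x, y}"] by metis
      then show ?thesis unfolding nbhd_iff using E S by blast
    qed
    have "\<not> verts S \<subseteq> {x}"
      using card_S card_mono[of "{x}" "verts S"] by auto
    then obtain y where "y \<in> verts S" "y \<noteq> x" by blast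
    then have pos: "deg x > 0" using adjacent deg_pos unfolding nbhd_iff by blast
    have "nbhd x \<subseteq> verts S"
    proof
      fix z assume "z \<in> nbhd x"
      then obtain e where e: "e \<in> E" "x \<in> e" "z \<in> e"
        unfolding nbhd_iff by blast
      then obtain T where T: "T \<in> \<S>" "e \<in> edges T"
        using E by blast
      then have "e \<subseteq> verts T" using steiner by (simp add: steiner_2_4_def)
      with e have "x \<in> verts T" "z \<in> verts T" by blast+
      moreover from this S T have "S = T" using disjoint by (metis disjoint_iff)
      ultimately show "z \<in> verts S" by simp
    qed
    then have "nbhd x = verts S" using adjacent nbhd_refl[OF pos] by blast
    then show ?thesis using card_nbhd[OF pos] card_S by simp
  qed
  then have "(\<Sum>x\<in>V. deg x) = (\<Sum>x\<in>V. 4)" by (intro sum.cong) simp_all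
  then show ?thesis using sum_deg by simp
qed

section \<open>From hypergraphs to the combinatorial axioms\<close>

lemma P3_subhypergraph:
  fixes H :: "'a hypergraph"
  assumes edges: "e \<in> edges H" "f \<in> edges H" "g \<in> edges H"
    and "e \<subseteq> verts H" "f \<subseteq> verts H" "g \<subseteq> verts H"
    and card: "card e = 4" "card f = 4" "card g = 4"
    and ef: "e \<inter> f = {a}" and fg: "f \<inter> g = {b}" and eg: "e \<inter> g = {}"
  shows "\<not> hypergraph_free path_P3 H"
proof -
  have ab: "a \<in> e" "a \<in> f" "b \<in> f" "b \<in> g" "a \<noteq> b" using ef fg eg by blast+
  have "card (e - {a}) = 3" "card (g - {b}) = 3" "card (f - {a, b}) = 2"
    using ab card by simp_all
  then obtain x1 x2 x3 x5 x6 x8 x9 x10 where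
    e': "e - {a} = {x1, x2, x3}" "x1 \<noteq> x2" "x1 \<noteq> x3" "x2 \<noteq> x3" and
    f': "f - {a, b} = {x5, x6}" "x5 \<noteq> x6" and
    g': "g - {b} = {x8, x9, x10}" "x8 \<noteq> x9" "x8 \<noteq> x10" "x9 \<noteq> x10"
    unfolding card_2_iff card_3_iff by metis
  have e: "e = {x1, x2, x3, a}" and f: "f = {a, x5, x6, b}" and g: "g = {b, x8, x9, x10}"
    using e' f' g' ab by blast+
  define xs where "xs = [x1, x2, x3, a, x5, x6, b, x8, x9, x10]"
  \<comment> \<open>The \<open>45\<close> inequalities behind \<open>distinct xs\<close> follow from \<open>4 + 4 + 4 - 1 - 1 = 10\<close>.\<close>
  have set_xs: "set xs = e \<union> f \<union> g"
    unfolding xs_def e f g by auto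
  have fin: "finite e" "finite f" "finite g"
    unfolding e f g by simp_all
  have "(e \<union> f) \<inter> g = {b}" using fg eg by blast
  then have "card (e \<union> f \<union> g) = 10"
    using card_Un_Int[of e f] card_Un_Int[of "e \<union> f" g] fin card ef by simp
  then have dist: "distinct xs"
    by (intro card_distinct) (simp add: set_xs, simp add: xs_def)
  define \<phi> where "\<phi> i = xs ! (i - 1)" for i
  have "inj_on \<phi> {1..10}"
  proof (rule inj_onI)
    fix i j :: nat
    assume ij: "i \<in> {1..10}" "j \<in> {1..10}" "\<phi> i = \<phi> j"
    then have "i - 1 < length xs" "j - 1 < length xs" by (auto simp: xs_def)
    then have "i - 1 = j - 1" using dist ij(3) by (simp add: \<phi>_def nth_eq_iff_index_eq)
    then show "i = j" using ij by auto
  qed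
  moreover have "\<phi> ` {1..10} = e \<union> f \<union> g"
  proof -
    have idx: "{1..10::nat} = {1, 2, 3, 4, 5, 6, 7, 8, 9, 10}"
      by (intro set_eqI) (simp, arith)
    have "\<phi> ` {1..10} = set xs"
      unfolding idx by (simp add: \<phi>_def xs_def)
    then show ?thesis using set_xs by simp
  qed
  moreover have "(`) \<phi> ` edges path_P3 = {e, f, g}"
    unfolding e f g by (simp add: path_P3_def \<phi>_def xs_def)
  ultimately have "isomorphic_hypergraphs path_P3 (e \<union> f \<union> g, {e, f, g})"
    unfolding isomorphic_hypergraphs_def bij_betw_def path_P3_def by (intro exI[of _ \<phi>]) simp
  moreover have "subhypergraph (e \<union> f \<union> g, {e, f, g}) H"
    using assms by (auto simp: subhypergraph_def)
  ultimately show ?thesis unfolding hypergraph_free_def by blast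
qed

lemma P3_free_quadruplesI:
  assumes quad: "quadruple_system H" and lin: "linear_hypergraph H"
    and free: "hypergraph_free path_P3 H"
  shows "P3_free_quadruples (verts H) (edges H)"
proof -
  have sub: "e \<subseteq> verts H" and card: "card e = 4" if "e \<in> edges H" for e
    using quad that by (auto simp: quadruple_system_def)
  have unique: "e = g" if "e \<in> edges H" "g \<in> edges H" "x \<in> e" "x \<in> g" "y \<in> e" "y \<in> g" "x \<noteq> y"
    for e g x y
  proof -
    have "\<exists>\<^sub>\<le>\<^sub>1 e. e \<in> edges H \<and> {x, y} \<subseteq> e"
      using lin sub that unfolding linear_hypergraph_def by blast
    then show ?thesis using that unfolding Uniq_def by blast
  qed
  show ?thesis
  proof
    show "finite (verts H)" using quad by (simp add: quadruple_system_def)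
  next
    fix e f g a b
    assume *: "e \<in> edges H" "f \<in> edges H" "g \<in> edges H" "a \<in> e" "a \<in> f" "b \<in> f" "b \<in> g"
      "a \<noteq> b" "e \<noteq> f" "g \<noteq> f"
    have "e \<inter> f = {a}" using unique[of e f a] * by blast
    moreover have "f \<inter> g = {b}" using unique[of f g b] * by blast
    ultimately show "e \<inter> g \<noteq> {}"
      using P3_subhypergraph[of e H f g a b] free sub card * by blast
  qed (use sub card unique in blast)+
qed

theorem proposition1p3:
  fixes n :: nat
  assumes "n > 0"
  shows "ex_lin4 n path_P3 \<le> n \<and>
    (\<forall>H :: 'a hypergraph.
       quadruple_system H \<and> linear_hypergraph H \<and> hypergraph_free path_P3 H \<and> card (verts H) = n \<longrightarrow>
         card (edges H) \<le> n \<and>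
         (card (edges H) = n \<longleftrightarrow> disjoint_union_of_steiner_13 H))"
proof (intro conjI allI impI)
  have "edges path_P3 \<noteq> {}" by (simp add: path_P3_def)
  note defined = ex_lin4_well_defined[OF this, of n]
  have "card (edges H) \<le> n" if "H \<in> lin_systems_nat n path_P3" for H
  proof -
    interpret P3_free_quadruples "verts H" "edges H"
      using that by (intro P3_free_quadruplesI) (auto simp: lin_systems_nat_def)
    show ?thesis using card_edges_le that by (simp add: lin_systems_nat_def)
  qed
  then show "ex_lin4 n path_P3 \<le> n"
    unfolding ex_lin4_def using defined by (subst Max_le_iff) auto
next
  fix H :: "'a hypergraph"
  assume H: "quadruple_system H \<and> linear_hypergraph H \<and> hypergraph_free path_P3 H \<and>
    card (verts H) = n"
  interpret P3_free_quadruples "verts H" "edges H"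
    using H by (intro P3_free_quadruplesI) auto
  show "card (edges H) \<le> n" using card_edges_le H by simp
  show "card (edges H) = n \<longleftrightarrow> disjoint_union_of_steiner_13 H"
  proof
    assume "card (edges H) = n"
    then have "disjoint_union_of_steiner_13 (verts H, edges H)"
      using H regular_if_card_eq by (intro steiner_union_if_regular) simp
    then show "disjoint_union_of_steiner_13 H" by simp
  next
    assume "disjoint_union_of_steiner_13 H"
    then show "card (edges H) = n" using card_eq_if_steiner_union H by simp
  qed
qed

end
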